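(* Let $p$ be a prime, let $l\in\mathbb N$, and let $f(x)\in\mathbb Q_p[x]$ be a polynomial with $\deg f\leq l$ and $f(a)\in\mathbb Z_p$ for all $a\in\mathbb Z$. Let $\alpha,\beta\in\mathbb N$ with $\alpha\geq\beta$. Then for all integers $n\geq p^{\alpha-1}$ and $r$ we have $$\sum_{k\equiv r\ (\mathrm{mod}\ p^{\beta})}\binom nk(-1)^k f\left(\left\lfloor\frac{k-r}{p^{\alpha}}\right\rfloor\right)\in p^{\left\lfloor\frac{n-p^{\alpha-1}-l}{\varphi(p^{\alpha})}\right\rfloor-(l-1)\alpha-\beta}\,\mathbb Z_p.$$ Moreover, if $\alpha>1$, then for all integers $n\geq p^{\alpha-1}$ and $r$ we also have $$\sum_{k\equiv r\ (\mathrm{mod}\ p^{\beta})}\binom nk(-1)^k f\left(\left\lfloor\frac{k-r}{p^{\alpha}}\right\rfloor\right)\in p^{\left\lfloor\frac{n-p^{\alpha-1}-\delta_{\beta,0}}{\varphi(p^{\alpha})}\right\rfloor-(l-1)\alpha-\beta}\,\mathbb Z_p.$$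
   Context: $\mathbb N=\{0,1,2,\ldots\}$. $\mathbb Q_p$ is the field of $p$-adic numbers and $\mathbb Z_p$ the ring of $p$-adic integers; for an integer $e$ (possibly negative), $p^e\mathbb Z_p=\{p^e z: z\in\mathbb Z_p\}\subseteq\mathbb Q_p$. $\varphi$ is Euler's totient function, with $\varphi(p^0)=1$. When $\alpha=0$, $p^{\alpha-1}$ denotes the rational number $1/p$. $\lfloor\cdot\rfloor$ is the floor function. $\delta_{m,n}$ is $1$ if $m=n$ and $0$ otherwise. The sums run over all integers $k$ in the given residue class; since $n\ge 0$ and $\binom nk=0$ for $k<0$ or $k>n$, only terms with $0\leq k\leq n$ contribute. *)

theory Defs
  imports
    "HOL-Computational_Algebra.Fraction_Field"
    "HOL-Computational_Algebra.Polynomial"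
    "HOL-Number_Theory.Number_Theory"
    "Berlekamp_Zassenhaus.Finite_Field"
begin

text \<open>
  The prime is carried by a type: \<open>'p :: prime_card\<close> stands for \<open>p = CARD('p)\<close>. The ring of
  \<open>p\<close>-adic integers is the inverse limit of the rings \<open>\<int> / p\<^sup>n\<int>\<close>. In the coherence condition below
  the residue class modulo \<open>p\<^sup>n\<close> is given by its representative in \<open>{0..<p^n}\<close>; that \<open>x n\<close> lies in
  this range is forced by the condition itself.
\<close>

typedef (overloaded) ('p :: prime_card) padic_int =
  "{x :: nat \<Rightarrow> int. \<forall>n. x (Suc n) mod int CARD('p) ^ n = x n}"
  morphisms padic_residue Abs_padic_int
  by (rule exI[of _ "\<lambda>_. 0"]) simp

setup_lifting type_definition_padic_int

lemma coherent_mod_power: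
  fixes x :: "nat \<Rightarrow> int" and q :: int
  assumes "\<forall>n. x (Suc n) mod q ^ n = x n" "m \<le> n"
  shows "x n mod q ^ m = x m"
  using assms(2)
proof (induction n rule: dec_induct)
  case base
  show ?case by (metis assms(1) mod_mod_trivial)
next
  case (step n)
  have "x (Suc n) mod q ^ m = x (Suc n) mod q ^ n mod q ^ m"
    using step.hyps(1) by (simp add: le_imp_power_dvd mod_mod_cancel)
  then show ?case using assms(1) step.IH by simp
qed

lemma mod_power_mod_power:
  fixes a q :: int
  shows "a mod q ^ Suc n mod q ^ n = a mod q ^ n"
  by (simp add: mod_mod_cancel)

instantiation padic_int :: (prime_card) comm_ring_1
begin

lift_definition zero_padic_int :: "'a padic_int" is "\<lambda>_. 0" by simp

lift_definition one_padic_int :: "'a padic_int" is "\<lambda>n. 1 mod int CARD('a) ^ n"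
  by (simp only: mod_power_mod_power simp_thms)

lift_definition plus_padic_int :: "'a padic_int \<Rightarrow> 'a padic_int \<Rightarrow> 'a padic_int"
  is "\<lambda>x y n. (x n + y n) mod int CARD('a) ^ n"
  by (simp only: mod_power_mod_power) (metis mod_add_eq)

lift_definition uminus_padic_int :: "'a padic_int \<Rightarrow> 'a padic_int"
  is "\<lambda>x n. (- x n) mod int CARD('a) ^ n"
  by (simp only: mod_power_mod_power) (metis mod_minus_eq)

lift_definition minus_padic_int :: "'a padic_int \<Rightarrow> 'a padic_int \<Rightarrow> 'a padic_int"
  is "\<lambda>x y n. (x n - y n) mod int CARD('a) ^ n"
  by (simp only: mod_power_mod_power) (metis mod_diff_eq)

lift_definition times_padic_int :: "'a padic_int \<Rightarrow> 'a padic_int \<Rightarrow> 'a padic_int"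
  is "\<lambda>x y n. (x n * y n) mod int CARD('a) ^ n"
  by (simp only: mod_power_mod_power) (metis mod_mult_eq)

instance
proof
  fix a b c :: "'a padic_int"
  show "a + b + c = a + (b + c)"
    by transfer (simp add: mod_simps ac_simps)
  show "a + b = b + a"
    by transfer (simp add: ac_simps)
  show "0 + a = a"
    by transfer (use coherent_mod_power in auto)
  show "- a + a = 0"
    by transfer (simp add: mod_simps)
  show "a - b = a + - b"
    by transfer (simp add: mod_simps)
  show "a * b * c = a * (b * c)"
    by transfer (simp add: mod_simps ac_simps)
  show "a * b = b * a"
    by transfer (simp add: ac_simps)
  show "1 * a = a"
    by transfer (use coherent_mod_power in \<open>auto simp: mod_simps\<close>)
  show "(a + b) * c = a * c + b * c"
    by transfer (simp add: mod_simps algebra_simps)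
  have "1 < int CARD('a)"
    using prime_card[where 'a = 'a] prime_gt_1_nat by auto
  then have "1 mod int CARD('a) ^ 1 \<noteq> 0"
    by simp
  then show "(0 :: 'a padic_int) \<noteq> 1"
    by transfer metis
qed

end

instance padic_int :: (prime_card) idom
proof
  fix a b :: "'a padic_int"
  assume "a \<noteq> 0" "b \<noteq> 0"
  then show "a * b \<noteq> 0"
  proof (transfer)
    fix x y :: "nat \<Rightarrow> int"
    let ?q = "int CARD('a)"
    assume x: "\<forall>n. x (Suc n) mod ?q ^ n = x n" "x \<noteq> (\<lambda>_. 0)"
      and y: "\<forall>n. y (Suc n) mod ?q ^ n = y n" "y \<noteq> (\<lambda>_. 0)"
    have q: "prime ?q"
      using prime_card[where 'a = 'a] by simp
    obtain i j where "x i \<noteq> 0" "y j \<noteq> 0"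
      using x(2) y(2) by (meson ext)
    then have "\<not> ?q ^ i dvd x (i + j)" "\<not> ?q ^ j dvd y (i + j)"
      using coherent_mod_power[OF x(1), of i "i + j"] coherent_mod_power[OF y(1), of j "i + j"]
      by (auto simp: dvd_eq_mod_eq_0)
    moreover have "a \<ge> i \<or> b \<ge> j" if "a + b = i + j" for a b
      using that by linarith
    ultimately have "\<not> ?q ^ (i + j) dvd x (i + j) * y (i + j)"
      using prime_elem_power_dvd_prod[of ?q "i + j" "x (i + j)" "y (i + j)"] q
      by (meson power_le_dvd prime_imp_prime_elem)
    then show "(\<lambda>n. x n * y n mod ?q ^ n) \<noteq> (\<lambda>_. 0)"
      by (metis dvd_eq_mod_eq_0)
  qed
qed

type_synonym 'p padic = "'p padic_int fract"

definition padic_integers :: "'p :: prime_card padic set" where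
  "padic_integers = range (\<lambda>z. Fraction_Field.Fract z 1)"

definition prime_power_padic_integers :: "int \<Rightarrow> 'p :: prime_card padic set" where
  "prime_power_padic_integers e = (\<lambda>z. of_nat CARD('p) powi e * z) ` padic_integers"

end

theory Submission
  imports Defs
begin

text \<open>
  Let \<open>S\<close> be the shift on functions \<open>\<int> \<rightarrow> \<int>\<^sub>p\<close> and \<open>x = S - 1\<close>. Up to sign the sum is the value at \<open>0\<close> of
  \<open>x\<^sup>n g\<close>, where \<open>g\<close> is \<open>k \<mapsto> f \<lfloor>(k - r) / p\<^sup>\<alpha>\<rfloor>\<close> cut off to the class of \<open>r\<close>. Since \<open>P = S^(p^\<alpha>) - 1\<close>
  acts on such functions by differencing \<open>f\<close>, the product \<open>P\<^sup>l M\<close> with \<open>M = S^(p^\<beta>) - 1\<close> annihilates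
  \<open>g\<close>. It therefore suffices that \<open>x\<^sup>n\<close> lies in the ideal \<open>(p\<^sup>E, P\<^sup>l M)\<close> of \<open>\<int>[S]\<close>.

  With \<open>y = S^(p^(\<alpha>-1)) - 1\<close>, the congruence \<open>P \<equiv> y\<^sup>p\<close> mod \<open>p y\<close> lets one trade \<open>y\<^sup>p\<close> for \<open>P\<close> or
  \<open>y\<^bsup>p-1\<^esup>\<close> for \<open>p\<close>, and \<open>x^(p^(\<alpha>-1)) \<equiv> y\<close> mod \<open>p\<close>; this puts high powers of \<open>x\<close> in \<open>(p\<^sup>e, P\<^sup>l)\<close>. The
  factor \<open>M\<close> is split off by \<open>x^(p^\<beta>) \<equiv> M\<close> mod \<open>p\<close>; for \<open>\<beta> = 0\<close> this is the equality \<open>x = M\<close>, whose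
  cost is the \<open>\<delta>\<^bsub>\<beta>,0\<^esub>\<close> of the statement.
\<close>

section \<open>Ideals generated by two elements\<close>

definition ideal2 :: "'a::comm_ring_1 \<Rightarrow> 'a \<Rightarrow> 'a set" where
  "ideal2 a b = {a * u + b * v | u v. True}"

lemma ideal2_add:
  assumes "z \<in> ideal2 a b" "w \<in> ideal2 a b"
  shows "z + w \<in> ideal2 a b"
proof -
  obtain u v u' v' where "z = a * u + b * v" "w = a * u' + b * v'"
    using assms by (auto simp: ideal2_def)
  then have "z + w = a * (u + u') + b * (v + v')" by (simp add: algebra_simps)
  then show ?thesis unfolding ideal2_def by blast
qed

lemma ideal2_mult:
  assumes "z \<in> ideal2 a b"
  shows "c * z \<in> ideal2 a b"
proof -
  obtain u v where "z = a * u + b * v"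
    using assms by (auto simp: ideal2_def)
  then have "c * z = a * (c * u) + b * (c * v)" by (simp add: algebra_simps)
  then show ?thesis unfolding ideal2_def by blast
qed

lemma ideal2_mult_left:
  assumes "z \<in> ideal2 a b"
  shows "c * z \<in> ideal2 (c * a) b"
proof -
  obtain u v where "z = a * u + b * v"
    using assms by (auto simp: ideal2_def)
  then have "c * z = c * a * u + b * (c * v)" by (simp add: algebra_simps)
  then show ?thesis unfolding ideal2_def by blast
qed

lemma ideal2_mult_right:
  assumes "z \<in> ideal2 a b"
  shows "c * z \<in> ideal2 a (c * b)"
proof -
  obtain u v where "z = a * u + b * v"
    using assms by (auto simp: ideal2_def)
  then have "c * z = a * (c * u) + c * b * v" by (simp add: algebra_simps)
  then show ?thesis unfolding ideal2_def by blast
qed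

lemma ideal2_multiple_left: "a * u \<in> ideal2 a b"
  unfolding ideal2_def by (rule CollectI, intro exI[of _ u] exI[of _ 0]) simp

lemma ideal2_one_left: "z \<in> ideal2 1 b"
  using ideal2_multiple_left[of 1 z b] by simp

lemma ideal2_one_right: "z \<in> ideal2 a 1"
  unfolding ideal2_def by (rule CollectI, intro exI[of _ 0] exI[of _ z]) simp

section \<open>Frobenius congruences modulo p\<close>

text \<open>The middle binomial coefficients are divisible by p and their powers of u by u. Keeping
  the factor u in the error term is what later lets y^p be traded for p y, a cost of only p - 1
  factors.\<close>

lemma prime_power_one_plus:
  fixes u :: "'a::comm_ring_1"
  assumes "prime p"
  obtains w where "(1 + u) ^ p = 1 + u ^ p + of_nat p * u * w"
proof -
  have p: "p > 0" using assms prime_gt_0_nat by blast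
  have "(1 + u) ^ p = (\<Sum>k\<le>p. of_nat (p choose k) * u ^ k)"
    using binomial_ring[of u 1 p] by (simp add: add.commute)
  also have "{..p} = insert 0 (insert p {0<..<p})" using p by auto
  also have "(\<Sum>k\<in>\<dots>. of_nat (p choose k) * u ^ k)
      = 1 + u ^ p + (\<Sum>k\<in>{0<..<p}. of_nat (p choose k) * u ^ k)"
    using p by (simp add: add.assoc)
  finally have eq: "(1 + u) ^ p = 1 + u ^ p + (\<Sum>k\<in>{0<..<p}. of_nat (p choose k) * u ^ k)" .
  have "of_nat p * u dvd (\<Sum>k\<in>{0<..<p}. of_nat (p choose k) * u ^ k)"
  proof (rule dvd_sum)
    fix k assume k: "k \<in> {0<..<p}"
    then have "p dvd (p choose k)"
      using assms by (intro dvd_choose_prime) auto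
    then have "(of_nat p :: 'a) dvd of_nat (p choose k)" by (metis dvd_def of_nat_mult)
    moreover have "u dvd u ^ k" using k by (simp add: dvd_power)
    ultimately show "of_nat p * u dvd of_nat (p choose k) * u ^ k" by (rule mult_dvd_mono)
  qed
  then show ?thesis using eq that by (elim dvdE) simp
qed

text \<open>Elements congruent modulo p have congruent p-th powers, so
  \<open>prime_power_one_plus\<close> can be iterated.\<close>

lemma prime_power_power_one_plus:
  fixes x :: "'a::comm_ring_1"
  assumes "prime p"
  shows "of_nat p dvd (1 + x) ^ (p ^ a) - 1 - x ^ (p ^ a)"
proof (induction a)
  case 0
  show ?case by simp
next
  case (Suc a)
  define y where "y = (1 + x) ^ (p ^ a) - 1"
  obtain w where w: "(1 + y) ^ p = 1 + y ^ p + of_nat p * y * w"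
    using prime_power_one_plus[OF assms] .
  have "(1 + x) ^ (p ^ Suc a) = (1 + y) ^ p"
    by (simp add: y_def mult.commute flip: power_mult)
  then have "(1 + x) ^ (p ^ Suc a) - 1 - x ^ (p ^ Suc a)
      = (y ^ p - (x ^ (p ^ a)) ^ p) + of_nat p * (y * w)"
    by (simp add: w mult_ac flip: power_mult)
  moreover have "of_nat p dvd y ^ p - (x ^ (p ^ a)) ^ p"
    using Suc.IH power_diff_sumr2[of y p "x ^ (p ^ a)"] unfolding y_def by (simp add: dvd_mult2)
  ultimately show ?case by simp
qed

section \<open>High powers in the ideals, by counting weights\<close>

text \<open>
  In the exponents below \<open>p\<close> has weight \<open>p - 1\<close>, \<open>y\<close> has weight \<open>1\<close> and \<open>P\<close> has weight \<open>p\<close>.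
\<close>

lemma power_in_ideal2_of_relation:
  fixes y P u :: "'a::comm_ring_1"
  assumes "2 \<le> p" and rel: "y ^ p = P - of_nat p * y * u"
    and "e * (p - 1) + l * p + 1 \<le> c"
  shows "y ^ c \<in> ideal2 (of_nat p ^ e) (P ^ Suc l)"
  using assms(3)
proof (induction c arbitrary: e l rule: less_induct)
  case (less c)
  show ?case
  proof (cases e)
    case 0
    then show ?thesis by (simp add: ideal2_one_left)
  next
    case (Suc e')
    have c: "c \<ge> p" and c': "e' * (p - 1) + l * p + 1 \<le> c - (p - 1)"
      using less.prems Suc assms(1) by auto
    \<comment> \<open>Of the two terms replacing y^p, the first spends p factors y on one P, the
      second p - 1 factors y on one p. So the induction hypothesis applies with l or e lowered by
      one.\<close>
    have "y ^ c = y ^ p * y ^ (c - p)" using c by (simp flip: power_add)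
    also have "\<dots> = P * y ^ (c - p) + (- u) * (of_nat p * y ^ (c - (p - 1)))"
    proof -
      have "c - (p - 1) = Suc (c - p)" using c assms(1) by simp
      then show ?thesis by (simp only: rel) (simp add: algebra_simps)
    qed
    also have "\<dots> \<in> ideal2 (of_nat p ^ e) (P ^ Suc l)"
    proof (rule ideal2_add)
      have "of_nat p * y ^ (c - (p - 1)) \<in> ideal2 (of_nat p ^ e) (P ^ Suc l)"
        using less.IH[OF _ c'] ideal2_mult_left c assms(1) unfolding Suc power_Suc by force
      then show "(- u) * (of_nat p * y ^ (c - (p - 1))) \<in> ideal2 (of_nat p ^ e) (P ^ Suc l)"
        by (rule ideal2_mult)
      show "P * y ^ (c - p) \<in> ideal2 (of_nat p ^ e) (P ^ Suc l)"
      proof (cases l)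
        \<comment> \<open>P is then itself the second generator, so nothing is required of the
          cofactor.\<close>
        case 0
        then show ?thesis using ideal2_mult_right[OF ideal2_one_right, of P] by simp
      next
        case (Suc l')
        have "e * (p - 1) + l' * p + 1 \<le> c - p" using less.prems Suc by simp
        then have "y ^ (c - p) \<in> ideal2 (of_nat p ^ e) (P ^ Suc l')"
          using less.IH c assms(1) by simp
        then show ?thesis unfolding Suc power_Suc[of P "Suc l'"] by (rule ideal2_mult_right)
      qed
    qed
    finally show ?thesis .
  qed
qed

text \<open>Each factor y + p v is expanded in turn. It contributes y, or else p v, which loses one
  unit of exponent but lowers e by one; as 1 \<le> d, the bound e d + N survives.\<close>

lemma perturbed_power_in_ideal2:
  fixes y v I :: "'a::comm_ring_1"
  assumes "1 \<le> d"
    and y: "\<And>e c. e * d + N \<le> c \<Longrightarrow> y ^ c \<in> ideal2 (of_nat p ^ e) I"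
    and "e * d + N \<le> c + m"
  shows "y ^ c * (y + of_nat p * v) ^ m \<in> ideal2 (of_nat p ^ e) I"
  using assms(3)
proof (induction m arbitrary: c e)
  case 0
  then show ?case using y by simp
next
  case (Suc m)
  have eq: "y ^ c * (y + of_nat p * v) ^ Suc m
      = y ^ Suc c * (y + of_nat p * v) ^ m + v * (of_nat p * (y ^ c * (y + of_nat p * v) ^ m))"
    by (simp add: algebra_simps)
  show ?case
  proof (cases e)
    case 0
    then show ?thesis by (simp add: ideal2_one_left)
  next
    case (Suc e')
    have "e' * d + N \<le> c + m" using Suc.prems assms(1) Suc by simp
    from ideal2_mult_left[OF Suc.IH[OF this], of "of_nat p"]
    have "of_nat p * (y ^ c * (y + of_nat p * v) ^ m) \<in> ideal2 (of_nat p ^ e) I"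
      by (simp add: Suc)
    moreover have "y ^ Suc c * (y + of_nat p * v) ^ m \<in> ideal2 (of_nat p ^ e) I"
      by (rule Suc.IH) (use Suc.prems in simp)
    ultimately show ?thesis unfolding eq using ideal2_add ideal2_mult by blast
  qed
qed

text \<open>Powers of \<open>y\<close> are handled by y^p = P - p y w, which comes from P = (1 +
  y)^p - 1. They transfer to x^(p^a), which differs from y by a multiple of p; the leftover x^(n mod
  p^a) is only a multiplier.\<close>

lemma power_in_ideal2_prime_power:
  fixes x :: "'a::comm_ring_1"
  assumes p: "prime p"
    and n: "p ^ a * (e * (p - 1) + l * p + 1) \<le> n"
  shows "x ^ n \<in> ideal2 (of_nat p ^ e) (((1 + x) ^ (p ^ Suc a) - 1) ^ Suc l)"
proof -
  define y where "y = (1 + x) ^ (p ^ a) - 1"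
  define P where "P = (1 + x) ^ (p ^ Suc a) - 1"
  define m where "m = n div p ^ a"
  have p2: "p \<ge> 2" using p prime_ge_2_nat by blast
  have m: "e * (p - 1) + (l * p + 1) \<le> 0 + m"
    using n p2 by (simp add: m_def less_eq_div_iff_mult_less_eq mult_ac)
  obtain w where w: "(1 + y) ^ p = 1 + y ^ p + of_nat p * y * w"
    using prime_power_one_plus[OF p] .
  have "P = (1 + y) ^ p - 1"
    by (simp add: P_def y_def mult.commute flip: power_mult)
  then have rel: "y ^ p = P - of_nat p * y * w" by (simp add: w)
  have y: "y ^ c \<in> ideal2 (of_nat p ^ e) (P ^ Suc l)" if "e * (p - 1) + (l * p + 1) \<le> c" for e c
    by (rule power_in_ideal2_of_relation[OF p2 rel]) (use that in simp)
  obtain v where v: "y - x ^ (p ^ a) = of_nat p * v"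
    using prime_power_power_one_plus[OF p, of x a] unfolding y_def by (elim dvdE)
  have x: "x ^ (p ^ a) = y + of_nat p * (- v)" by (simp flip: v)
  have d: "1 \<le> p - 1" using p2 by simp
  have "x ^ n = x ^ (n mod p ^ a) * (x ^ (p ^ a)) ^ m"
    by (simp add: m_def flip: power_mult power_add)
  moreover have "(x ^ (p ^ a)) ^ m \<in> ideal2 (of_nat p ^ e) (P ^ Suc l)"
    using perturbed_power_in_ideal2[where c = 0, OF d y m, of "- v"] unfolding x by simp
  ultimately show ?thesis unfolding P_def using ideal2_mult by metis
qed

text \<open>Unfolding x^b = M + p z over k blocks leaves (p z)^k x^s plus M times terms (p z)^j x^(b
  (k-1-j) + s). The factor p^j reduces e to e - j, freeing j d units of exponent against j b lost,
  hence b \<le> d. The extra b in the last hypothesis pays for the single factor M.\<close>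

lemma power_decomposition:
  fixes x M z I :: "'a::comm_ring_1"
  assumes rel: "x ^ b = M + of_nat p * z" and "b \<le> d"
    and x: "\<And>e t. e * d + N \<le> t \<Longrightarrow> x ^ t \<in> ideal2 (of_nat p ^ e) I"
    and "e = 0 \<or> e * d + N + b \<le> b * k + s"
  shows "\<exists>w. \<exists>v \<in> ideal2 (of_nat p ^ e) I. x ^ (b * k + s) = of_nat p ^ k * w + M * v"
  using assms(4)
proof (induction k arbitrary: e)
  case 0
  have "(0 :: 'a) \<in> ideal2 (of_nat p ^ e) I"
    using ideal2_multiple_left[of _ 0] by simp
  then show ?case by (intro exI[of _ "x ^ s"] bexI[of _ 0]) auto
next
  case (Suc k)
  \<comment> \<open>The subtraction is truncated: at e = 0 the ideal is the whole ring and v is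
    unconstrained.\<close>
  have "e - 1 = 0 \<or> (e - 1) * d + N + b \<le> b * k + s"
    using Suc.prems \<open>b \<le> d\<close> by (cases e) auto
  from Suc.IH[OF this] obtain w v where
    v: "v \<in> ideal2 (of_nat p ^ (e - 1)) I" and eq: "x ^ (b * k + s) = of_nat p ^ k * w + M * v"
    by blast
  have v': "of_nat p * v \<in> ideal2 (of_nat p ^ e) I"
    using ideal2_mult_left[OF v, of "of_nat p"] by (cases e) (auto simp: ideal2_one_left)
  have "x ^ (b * Suc k + s) = x ^ b * x ^ (b * k + s)" by (simp add: power_add)
  also have "\<dots> = M * x ^ (b * k + s) + of_nat p * z * x ^ (b * k + s)"
    unfolding rel by (rule distrib_right)
  also have "of_nat p * z * x ^ (b * k + s) = of_nat p * z * (of_nat p ^ k * w + M * v)"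
    by (simp only: eq)
  also have "M * x ^ (b * k + s) + \<dots> = of_nat p ^ Suc k * (z * w) + M * (x ^ (b * k + s) + z * (of_nat p * v))"
    by (simp add: algebra_simps)
  finally have "x ^ (b * Suc k + s) = \<dots>" .
  moreover have "x ^ (b * k + s) \<in> ideal2 (of_nat p ^ e) I"
  proof (cases "e = 0")
    case True
    then show ?thesis by (simp add: ideal2_one_left)
  next
    case False
    then show ?thesis using x[of e "b * k + s"] Suc.prems by simp
  qed
  then have "x ^ (b * k + s) + z * (of_nat p * v) \<in> ideal2 (of_nat p ^ e) I"
    using v' ideal2_add ideal2_mult by blast
  ultimately show ?case by blast
qed

text \<open>For l = 0 this fits e blocks of length p^\<beta> into n. The excess
  \<open>Suc a - \<beta>\<close> = d + 1 is absorbed by the summand p^a, since d + 1 \<le> p^d and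
  p^\<beta> p^d = p^a.\<close>

lemma prime_power_mult_le:
  fixes p :: nat
  assumes "2 \<le> p" "1 \<le> \<beta>" "\<beta> \<le> a"
    and "p ^ a * (p - 1) * (e - (Suc a - \<beta>)) + p ^ a \<le> n"
  shows "p ^ \<beta> * e \<le> n"
proof -
  define d where "d = a - \<beta>"
  define F where "F = e - (Suc a - \<beta>)"
  have "e \<le> (d + 1) + F" using assms(3) unfolding d_def F_def by simp
  also have "d + 1 \<le> p ^ d"
  proof -
    have "d < 2 ^ d" by (rule less_exp)
    also have "2 ^ d \<le> p ^ d" using assms(1) by (rule power_mono) simp
    finally show ?thesis by simp
  qed
  also have "p ^ d + F \<le> p ^ d + p ^ d * (p - 1) * F"
  proof -
    have "1 * F \<le> p ^ d * (p - 1) * F" using assms(1) by (intro mult_right_mono) auto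
    then show ?thesis by simp
  qed
  finally have "p ^ \<beta> * e \<le> p ^ \<beta> * (p ^ d + p ^ d * (p - 1) * F)" by simp
  also have "\<dots> = p ^ a * (p - 1) * F + p ^ a"
    using assms(3) by (simp add: d_def algebra_simps flip: power_add)
  finally show ?thesis using assms(4) unfolding F_def by simp
qed

text \<open>Here \<open>t\<close> is the correction in the numerator of the exponent: l for the
  first bound, \<delta> for the second. Its conditions cover the loss of weight at \<alpha> = 1 and
  the factor x spent on M at \<beta> = 0.\<close>

lemma power_in_ideal2_mixed:
  fixes x :: "'a::comm_ring_1"
  assumes p: "prime p" and "1 \<le> \<alpha>" "\<beta> \<le> \<alpha>"
    and n: "p ^ (\<alpha> - 1) \<le> n"
    and t: "0 \<le> t" "\<alpha> = 1 \<Longrightarrow> t = int l" "\<beta> = 0 \<Longrightarrow> 0 < l \<Longrightarrow> 1 \<le> t"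
    and E: "(int e + (int l - 1) * int \<alpha> + int \<beta>) * int (p ^ (\<alpha> - 1) * (p - 1))
              + int (p ^ (\<alpha> - 1)) + t \<le> int n"
  shows "x ^ n \<in> ideal2 (of_nat p ^ e) (((1 + x) ^ (p ^ \<alpha>) - 1) ^ l * ((1 + x) ^ (p ^ \<beta>) - 1))"
proof -
  define a where "a = \<alpha> - 1"
  have \<alpha>: "\<alpha> = Suc a" using assms(2) by (simp add: a_def)
  define \<phi> where "\<phi> = p ^ a * (p - 1)"
  have p2: "p \<ge> 2" using p prime_ge_2_nat by blast
  have q: "p ^ \<alpha> = \<phi> + p ^ a"
    using p2 by (simp add: \<alpha> \<phi>_def algebra_simps)
  have \<phi>: "p ^ a \<le> \<phi>"
    using p2 by (simp add: \<phi>_def)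
  \<comment> \<open>L p^\<alpha> is the cost of L factors P, and L \<alpha> \<phi> is what the
    exponent provides. This suffices for \<alpha> \<ge> 2, as p^\<alpha> \<le> 2 \<phi>; for
    \<alpha> = 1 it falls short by one per factor.\<close>
  have H: "int L * int (p ^ \<alpha>) \<le> int L * int \<alpha> * int \<phi> + (if \<alpha> = 1 then int L else 0)" for L
  proof (cases "\<alpha> = 1")
    case True
    then show ?thesis using q by (simp add: \<alpha> algebra_simps)
  next
    case False
    then have "2 * \<phi> \<le> \<alpha> * \<phi>" using assms(2) by (intro mult_right_mono) auto
    then have "p ^ \<alpha> \<le> \<alpha> * \<phi>" using q \<phi> by linarith
    then have "L * p ^ \<alpha> \<le> L * (\<alpha> * \<phi>)" by (rule mult_left_mono) simp
    then have "int (L * p ^ \<alpha>) \<le> int (L * (\<alpha> * \<phi>))" by (simp only: of_nat_le_iff)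
    then show ?thesis using False by (simp add: mult.assoc)
  qed
  define P where "P = (1 + x) ^ (p ^ \<alpha>) - 1"
  have E': "(int e + (int l - 1) * int \<alpha> + int \<beta>) * int \<phi> + int (p ^ a) + t \<le> int n"
    using E by (simp add: \<phi>_def a_def)
  have P: "x ^ t \<in> ideal2 (of_nat p ^ e) (P ^ l)"
    if "0 < l" "e * \<phi> + ((l - 1) * p ^ \<alpha> + p ^ a) \<le> t" for e l t
  proof -
    have "p ^ a * (e * (p - 1) + (l - 1) * p + 1) = e * \<phi> + ((l - 1) * p ^ \<alpha> + p ^ a)"
      by (simp add: \<alpha> \<phi>_def distrib_left mult_ac)
    then show ?thesis
      using power_in_ideal2_prime_power[OF p, of a e "l - 1" t x] that by (simp add: P_def \<alpha>)
  qed
  consider "\<beta> = 0" | "\<beta> = \<alpha>" | "1 \<le> \<beta>" "\<beta> \<le> a" using assms(3) \<alpha> by linarith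
  then show ?thesis
  proof cases
    \<comment> \<open>Now M = x, so one factor x is split off exactly and n - 1 remain for
      P^l.\<close>
    case 1
    have "x ^ (n - 1) \<in> ideal2 (of_nat p ^ e) (P ^ l)"
    proof (cases l)
      case 0
      then show ?thesis by (simp add: ideal2_one_right)
    next
      case (Suc L)
      have "int e * int \<phi> + int L * int \<alpha> * int \<phi> + int (p ^ a) + t \<le> int n"
        using E' by (simp add: Suc 1 algebra_simps)
      then have "int e * int \<phi> + (int L * int (p ^ \<alpha>) + int (p ^ a)) \<le> int n - 1"
        using H[of L] t(2,3) 1 Suc by (auto split: if_splits)
      then have "int (e * \<phi> + (L * p ^ \<alpha> + p ^ a)) \<le> int n - 1" by simp
      then have "e * \<phi> + (L * p ^ \<alpha> + p ^ a) \<le> n - 1" by linarith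
      then show ?thesis using P[of l e "n - 1"] Suc by simp
    qed
    moreover have "n \<noteq> 0" using n p2 by (intro notI) simp
    then have "x ^ n = x * x ^ (n - 1)" by (simp add: power_eq_if)
    ultimately show ?thesis
      using ideal2_mult_right[of "x ^ (n - 1)" "of_nat p ^ e" "P ^ l" x]
      by (simp add: 1 P_def mult.commute)
  next
    \<comment> \<open>Now M = P, so the second generator is P^(l+1).\<close>
    case 2
    have "int e * int \<phi> + int l * int \<alpha> * int \<phi> + int (p ^ a) + t \<le> int n"
      using E' by (simp add: 2 algebra_simps)
    then have "int e * int \<phi> + (int l * int (p ^ \<alpha>) + int (p ^ a)) \<le> int n"
      using H[of l] t by (auto split: if_splits)
    then have "int (e * \<phi> + (l * p ^ \<alpha> + p ^ a)) \<le> int n" by simp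
    then have "e * \<phi> + (l * p ^ \<alpha> + p ^ a) \<le> n" by linarith
    then show ?thesis using P[of "Suc l" e n] by (simp add: 2 P_def mult.commute)
  next
    case 3
    define b where "b = p ^ \<beta>"
    define M where "M = (1 + x) ^ b - 1"
    obtain v where v: "M - x ^ b = of_nat p * v"
      using prime_power_power_one_plus[OF p, of x \<beta>] unfolding M_def b_def by (elim dvdE)
    have rel: "x ^ b = M + of_nat p * (- v)" by (simp flip: v)
    have "b \<le> p ^ a" using 3 p2 by (simp add: b_def power_increasing)
    then have b: "b \<le> \<phi>" using \<phi> by simp
    \<comment> \<open>The decomposition runs over e blocks of length b, so that its part without M
      is divisible by p^e; they must fit into n.\<close>
    have e: "b * e \<le> n"
    proof (cases l)
      case 0
      show ?thesis unfolding b_def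
      proof (rule prime_power_mult_le[OF p2 3])
        show "p ^ a * (p - 1) * (e - (Suc a - \<beta>)) + p ^ a \<le> n"
        proof (cases "e \<le> Suc a - \<beta>")
          case True
          then show ?thesis using n by (simp add: a_def)
        next
          case False
          then have "int (e - (Suc a - \<beta>)) = int e + (int l - 1) * int \<alpha> + int \<beta>"
            using 0 3 by (simp add: \<alpha>)
          then have "int (e - (Suc a - \<beta>)) * int \<phi> + int (p ^ a) \<le> int n"
            using E' t(1) by simp
          then have "int ((e - (Suc a - \<beta>)) * \<phi> + p ^ a) \<le> int n" by simp
          then show ?thesis unfolding of_nat_le_iff \<phi>_def by (simp add: mult_ac)
        qed
      qed
    next
      case (Suc L)
      have "int e * int \<phi> + int L * int \<alpha> * int \<phi> + int \<beta> * int \<phi> + int (p ^ a) + t \<le> int n"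
        using E' by (simp add: Suc algebra_simps)
      moreover have "0 \<le> int L * int \<alpha> * int \<phi>" "0 \<le> int \<beta> * int \<phi>" "0 \<le> int (p ^ a)" by simp_all
      ultimately have "int (e * \<phi>) \<le> int n" using t(1) unfolding of_nat_mult by linarith
      moreover have "b * e \<le> e * \<phi>" using b by (simp add: mult.commute)
      ultimately show ?thesis by linarith
    qed
    have "\<exists>w. \<exists>v \<in> ideal2 (of_nat p ^ e) (P ^ l). x ^ n = of_nat p ^ e * w + M * v"
    proof (cases l)
      case 0
      \<comment> \<open>As P^0 = 1, the ideal is the whole ring and exponent 0 can be passed; only
        the number e of blocks matters.\<close>
      then show ?thesis
        using power_decomposition[OF rel b, of 0 1 0 e "n - b * e"] e
        by (fastforce simp: ideal2_one_right)
    next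
      case (Suc L)
      have "int e * int \<phi> + int L * int \<alpha> * int \<phi> + int \<beta> * int \<phi> + int (p ^ a) + t \<le> int n"
        using E' by (simp add: Suc algebra_simps)
      \<comment> \<open>One of the \<beta> copies of \<phi> pays for the factor M, since b \<le>
        \<phi>; hence t \<ge> 0 is enough.\<close>
      moreover have "1 * int \<phi> \<le> int \<beta> * int \<phi>" using 3 by (intro mult_right_mono) auto
      ultimately have "int e * int \<phi> + (int L * int (p ^ \<alpha>) + int (p ^ a)) + int b \<le> int n"
        using H[of L] b t(1) 3 \<alpha> by auto
      then have "int (e * \<phi> + (L * p ^ \<alpha> + p ^ a) + b) \<le> int n" by simp
      then have "e * \<phi> + (L * p ^ \<alpha> + p ^ a) + b \<le> n" by linarith
      then show ?thesis
        using power_decomposition[OF rel b, of "L * p ^ \<alpha> + p ^ a" "P ^ l" e e "n - b * e"]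
          P[of l] Suc e by simp
    qed
    then obtain w v where v: "v \<in> ideal2 (of_nat p ^ e) (P ^ l)"
      and eq: "x ^ n = of_nat p ^ e * w + M * v" by blast
    have "M * v \<in> ideal2 (of_nat p ^ e) (M * P ^ l)" using v by (rule ideal2_mult_right)
    then have "x ^ n \<in> ideal2 (of_nat p ^ e) (M * P ^ l)"
      unfolding eq by (intro ideal2_add ideal2_multiple_left)
    then show ?thesis by (simp add: M_def P_def b_def mult.commute)
  qed
qed

section \<open>Integer polynomials in the shift\<close>

text \<open>The action of \<int>[S] on functions on \<int>, with \<open>[:0, 1:]\<close> as S.
  Coefficients stay in \<int>, so the ideal membership is independent of the ring of values.\<close>

definition shift_apply :: "int poly \<Rightarrow> (int \<Rightarrow> 'a::comm_ring_1) \<Rightarrow> int \<Rightarrow> 'a" where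
  "shift_apply A g k = (\<Sum>i\<le>degree A. of_int (coeff A i) * g (k + int i))"

lemma shift_apply_eq_sum:
  assumes "degree A \<le> N"
  shows "shift_apply A g k = (\<Sum>i\<le>N. of_int (coeff A i) * g (k + int i))"
  unfolding shift_apply_def
  by (rule sum.mono_neutral_left) (use assms in \<open>auto simp: coeff_eq_0\<close>)

lemma shift_apply_0 [simp]: "shift_apply 0 g k = 0"
  by (simp add: shift_apply_def)

lemma shift_apply_pCons [simp]: "shift_apply (pCons a A) g k = of_int a * g k + shift_apply A g (k + 1)"
proof -
  have "shift_apply (pCons a A) g k = (\<Sum>i\<le>Suc (degree A). of_int (coeff (pCons a A) i) * g (k + int i))"
    by (rule shift_apply_eq_sum) (rule degree_pCons_le)
  also have "\<dots> = of_int a * g k + (\<Sum>i\<le>degree A. of_int (coeff A i) * g (k + 1 + int i))"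
    by (simp only: sum.atMost_Suc_shift) (simp add: ac_simps)
  finally show ?thesis by (simp add: shift_apply_def)
qed

lemma shift_apply_add: "shift_apply (A + B) g k = shift_apply A g k + shift_apply B g k"
proof -
  define N where "N = max (degree A) (degree B)"
  have N: "degree A \<le> N" "degree B \<le> N" "degree (A + B) \<le> N"
    by (auto simp: N_def degree_add_le)
  show ?thesis
    unfolding N[THEN shift_apply_eq_sum] by (simp add: algebra_simps sum.distrib)
qed

lemma shift_apply_smult: "shift_apply (smult c A) g k = of_int c * shift_apply A g k"
  using shift_apply_eq_sum[OF degree_smult_le, of c A g k]
  by (simp add: shift_apply_def sum_distrib_left mult.assoc)

lemma shift_apply_minus: "shift_apply (- A) g k = - shift_apply A g k"
  by (simp add: shift_apply_def sum_negf)

lemma shift_apply_mult: "shift_apply (A * B) g k = shift_apply A (shift_apply B g) k"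
  by (induction A arbitrary: k) (simp_all add: shift_apply_add shift_apply_smult)

lemma shift_apply_of_nat_mult: "shift_apply (of_nat m * A) g k = of_nat m * shift_apply A g k"
  by (simp add: of_nat_poly shift_apply_smult)

lemma shift_apply_zero_fun [simp]: "shift_apply A (\<lambda>_. 0) k = 0"
  by (simp add: shift_apply_def)

lemma shift_apply_power_shift: "shift_apply ([:0, 1:] ^ m) g k = g (k + int m)"
  by (induction m arbitrary: k) (simp_all add: shift_apply_mult one_pCons ac_simps)

lemma shift_apply_power_shift_minus_1:
  "shift_apply ([:0, 1:] ^ m - 1) g k = g (k + int m) - g k"
  by (simp only: diff_conv_add_uminus shift_apply_add shift_apply_minus shift_apply_power_shift)
    (simp add: one_pCons)

lemma shift_apply_one_minus_shift_power:
  "shift_apply ([:1, -1:] ^ n) g k = (\<Sum>i\<le>n. of_nat (n choose i) * (-1) ^ i * g (k + int i))"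
proof -
  have "degree ([:1, -1:: int:] ^ n) \<le> n"
    using degree_power_le[of "[:1, -1:: int:]" n] by simp
  then show ?thesis
    by (simp add: shift_apply_eq_sum[of _ n] coeff_linear_poly_power)
qed

section \<open>Differencing a polynomial along a residue class\<close>

lemma degree_pcompose_shift_diff:
  fixes f :: "'a::idom poly"
  assumes "degree f \<le> Suc l"
  shows "degree (pcompose f [:1, 1:] - f) \<le> l"
  using assms
proof (induction f arbitrary: l)
  case 0
  then show ?case by simp
next
  case (pCons a g)
  show ?case
  proof (cases "degree g = 0")
    case True
    then obtain c where "g = [:c:]" by (meson degree_eq_zeroE)
    then show ?thesis by (simp add: pcompose_pCons)
  next
    case False
    then have g: "degree g \<le> l" using pCons.prems by (auto split: if_splits)
    define D where "D = pcompose g [:1, 1:] - g"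
    obtain l' where l: "l = Suc l'" using False g by (cases l) auto
    have "degree D \<le> l'" unfolding D_def by (rule pCons.IH) (use g l in simp)
    then have "degree (pCons 0 D) \<le> l" using degree_pCons_le[of 0 D] l by simp
    moreover have "degree (pcompose g [:1, 1:]) \<le> l" using g by simp
    \<comment> \<open>For the forward difference \<Delta> this is \<Delta>(a + x g) = g(x + 1) + x
      \<Delta>g, which passes the degree drop from g to a + x g.\<close>
    moreover have "pcompose (pCons a g) [:1, 1:] - pCons a g = pcompose g [:1, 1:] + pCons 0 D"
      by (simp add: pcompose_pCons D_def algebra_simps)
    ultimately show ?thesis by (simp only: degree_add_le)
  qed
qed

definition residue_poly_fun :: "nat \<Rightarrow> nat \<Rightarrow> int \<Rightarrow> 'a::comm_ring_1 poly \<Rightarrow> int \<Rightarrow> 'a" where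
  "residue_poly_fun b q r f k =
    (if [k = r] (mod int b) then poly f (of_int ((k - r) div int q)) else 0)"

text \<open>As b divides q, a move by q stays in the residue class and raises the floor by
  one.\<close>

lemma residue_poly_fun_shift_diff:
  assumes "b dvd q" "0 < q"
  shows "residue_poly_fun b q r f (k + int q) - residue_poly_fun b q r f k
    = residue_poly_fun b q r (pcompose f [:1, 1:] - f) k"
proof -
  have "[int q = 0] (mod int b)" using assms(1) by (simp add: cong_0_iff)
  then have "[k + int q = k + 0] (mod int b)" by (intro cong_add cong_refl)
  then have "[k + int q = r] (mod int b) \<longleftrightarrow> [k = r] (mod int b)"
    using cong_trans cong_sym by (metis add.right_neutral)
  moreover have "(k + int q - r) div int q = (k - r) div int q + 1"
    using assms(2) div_add_self2[of "int q" "k - r"] by (simp add: algebra_simps)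
  ultimately show ?thesis
    by (simp add: residue_poly_fun_def poly_pcompose add.commute)
qed

text \<open>Each factor S^q - 1 differences f and lowers its degree bound by one. After l of them f
  is constant, the function has period b, and S^b - 1 kills it.\<close>

lemma shift_apply_annihilates_residue_poly_fun:
  fixes f :: "'a::idom poly"
  assumes "b dvd q" "0 < q" "degree f \<le> l"
  shows "shift_apply (([:0, 1:] ^ q - 1) ^ l * ([:0, 1:] ^ b - 1)) (residue_poly_fun b q r f)
    = (\<lambda>_. 0)"
  using assms(3)
proof (induction l arbitrary: f)
  case 0
  then obtain c where "f = [:c:]" by (metis degree_eq_zeroE le_zero_eq)
  then show ?case
    by (auto simp: shift_apply_power_shift_minus_1 residue_poly_fun_def fun_eq_iff cong_def)
next
  case (Suc l)
  define D :: "int poly" where "D = ([:0, 1:] ^ q - 1) ^ l * ([:0, 1:] ^ b - 1)"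
  have "([:0, 1:] ^ q - 1) ^ Suc l * ([:0, 1:] ^ b - 1) = D * ([:0, 1:] ^ q - 1 :: int poly)"
    by (simp add: D_def mult_ac)
  moreover have "shift_apply ([:0, 1:] ^ q - 1) (residue_poly_fun b q r f)
      = residue_poly_fun b q r (pcompose f [:1, 1:] - f)"
    by (rule ext)
      (simp add: shift_apply_power_shift_minus_1 residue_poly_fun_shift_diff[OF assms(1,2)])
  moreover have "shift_apply D (residue_poly_fun b q r (pcompose f [:1, 1:] - f)) = (\<lambda>_. 0)"
    unfolding D_def by (rule Suc.IH[OF degree_pcompose_shift_diff[OF Suc.prems]])
  ultimately show ?case by (intro ext) (simp only: shift_apply_mult)
qed

section \<open>Integrality in the p-adic field\<close>

lemma padic_integers_add: "x \<in> padic_integers \<Longrightarrow> y \<in> padic_integers \<Longrightarrow> x + y \<in> padic_integers"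
  unfolding padic_integers_def by (auto intro!: image_eqI[where x = "_ + _"])

lemma padic_integers_mult: "x \<in> padic_integers \<Longrightarrow> y \<in> padic_integers \<Longrightarrow> x * y \<in> padic_integers"
  unfolding padic_integers_def by auto

lemma padic_integers_of_int: "of_int m \<in> padic_integers"
proof -
  have nat: "of_nat k = Fraction_Field.Fract (of_nat k) (1 :: 'a padic_int)" for k
    by (rule of_nat_fract)
  show ?thesis
    unfolding padic_integers_def by (cases m rule: int_cases2) (auto simp: nat)
qed

lemma padic_integers_of_nat_power: "of_nat m ^ i \<in> padic_integers"
  using padic_integers_of_int[of "int m ^ i"] by simp

lemma padic_integers_sum:
  assumes "\<And>i. i \<in> I \<Longrightarrow> h i \<in> padic_integers"
  shows "sum h I \<in> padic_integers"
  using assms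
  by (induction I rule: infinite_finite_induct)
    (use padic_integers_of_int[of 0] padic_integers_add in auto)

lemma shift_apply_in_padic_integers:
  assumes "\<And>j. g j \<in> padic_integers"
  shows "shift_apply A g k \<in> padic_integers"
  unfolding shift_apply_def
  by (intro padic_integers_sum padic_integers_mult padic_integers_of_int assms)

lemma of_nat_CARD_padic_nonzero: "(of_nat CARD('p) :: 'p::prime_card padic) \<noteq> 0"
proof
  have res: "padic_residue (of_nat m :: 'p padic_int) n = int m mod int CARD('p) ^ n" for m n
    by (induction m) (simp_all add: zero_padic_int.rep_eq one_padic_int.rep_eq plus_padic_int.rep_eq mod_simps add.commute)
  assume "(of_nat CARD('p) :: 'p padic) = 0"
  then have "(of_nat CARD('p) :: 'p padic_int) = 0"
    by (simp add: of_nat_fract Zero_fract_def eq_fract)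
  \<comment> \<open>Level 2 is the first at which the residue of p is nonzero.\<close>
  then have "int CARD('p) mod int CARD('p) ^ 2 = 0"
    using res[of "CARD('p)" 2] by (simp add: zero_padic_int.rep_eq)
  moreover have "1 < CARD('p)" using prime_card[where 'a = 'p] prime_gt_1_nat by auto
  ultimately show False by (simp add: power2_eq_square)
qed

lemma prime_power_padic_integersI:
  assumes "z \<in> padic_integers" "E \<le> int e"
  shows "of_nat CARD('p) ^ e * z \<in> (prime_power_padic_integers E :: 'p::prime_card padic set)"
proof -
  let ?p = "of_nat CARD('p) :: 'p padic"
  have "?p ^ e = ?p powi E * ?p powi (int e - E)"
    using of_nat_CARD_padic_nonzero[where 'p = 'p] by (simp flip: power_int_add)
  also have "?p powi (int e - E) = ?p ^ nat (int e - E)"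
    using assms(2) by (simp add: power_int_def)
  finally have "?p ^ e * z = ?p powi E * (?p ^ nat (int e - E) * z)" by simp
  moreover have "?p ^ nat (int e - E) * z \<in> padic_integers"
    by (intro padic_integers_mult padic_integers_of_nat_power assms(1))
  ultimately show ?thesis unfolding prime_power_padic_integers_def by blast
qed

section \<open>From ideal membership to the alternating sum\<close>

text \<open>In (1 - S)^n = p^e u + v J the operator J annihilates g, so the sum is p^e times the
  integral value of u applied to g.\<close>

lemma alternating_sum_in_prime_power_padic_integers:
  fixes f :: "'p::prime_card padic poly"
  assumes deg: "degree f \<le> l"
    and int_valued: "\<forall>a :: int. poly f (of_int a) \<in> padic_integers"
    and le: "\<beta> \<le> \<alpha>"
    and I: "\<And>e. int e = E \<Longrightarrow> 0 < e \<Longrightarrow> [:-1, 1:] ^ n \<in> ideal2 (of_nat CARD('p) ^ e)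
        (((1 + [:-1, 1:]) ^ (CARD('p) ^ \<alpha>) - 1) ^ l * ((1 + [:-1, 1:]) ^ (CARD('p) ^ \<beta>) - 1) :: int poly)"
  shows "(\<Sum>k | k \<le> n \<and> [int k = r] (mod int (CARD('p) ^ \<beta>)).
      of_nat (n choose k) * (-1) ^ k
        * poly f (of_int \<lfloor>of_int (int k - r) / (of_nat (CARD('p) ^ \<alpha>) :: rat)\<rfloor>))
    \<in> prime_power_padic_integers E"
proof -
  define b where "b = CARD('p) ^ \<beta>"
  define q where "q = CARD('p) ^ \<alpha>"
  define g where "g = residue_poly_fun b q r f"
  \<comment> \<open>For E \<le> 0 this is 0, and integrality of the sum is enough.\<close>
  define e where "e = nat E"
  define J :: "int poly" where "J = ([:0, 1:] ^ q - 1) ^ l * ([:0, 1:] ^ b - 1)"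
  have S: "1 + [:-1, 1:] = ([:0, 1:] :: int poly)" by (simp add: one_pCons)
  have "[:-1, 1:] ^ n \<in> ideal2 (of_nat CARD('p) ^ e) J"
  proof (cases "e = 0")
    case True
    then show ?thesis by (simp add: ideal2_one_left)
  next
    case False
    then show ?thesis using I[of e] by (simp add: S J_def b_def q_def e_def)
  qed
  \<comment> \<open>The sign turns (S - 1)^n into (1 - S)^n, whose coefficients are the signed
    binomials of the sum.\<close>
  then have "(-1) ^ n * [:-1, 1:] ^ n \<in> ideal2 (of_nat CARD('p) ^ e) J" by (rule ideal2_mult)
  also have "(-1) ^ n * [:-1, 1:] ^ n = ([:1, -1:] ^ n :: int poly)"
    by (simp flip: power_mult_distrib)
  finally obtain u v where uv: "[:1, -1:] ^ n = of_nat CARD('p) ^ e * u + v * J"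
    unfolding ideal2_def by (auto simp: mult.commute)
  have "b dvd q" "0 < q" using le by (auto simp: b_def q_def le_imp_power_dvd)
  then have J: "shift_apply J g = (\<lambda>_. 0)"
    unfolding J_def g_def using deg by (rule shift_apply_annihilates_residue_poly_fun)
  have g: "g j \<in> padic_integers" for j
    using int_valued padic_integers_of_int[where 'a = 'p, of 0] by (simp add: g_def residue_poly_fun_def)
  have "(\<Sum>k | k \<le> n \<and> [int k = r] (mod int (CARD('p) ^ \<beta>)).
      of_nat (n choose k) * (-1) ^ k
        * poly f (of_int \<lfloor>of_int (int k - r) / (of_nat (CARD('p) ^ \<alpha>) :: rat)\<rfloor>))
    = (\<Sum>k\<le>n. of_nat (n choose k) * (-1) ^ k * g (int k))"
  proof (rule sum.mono_neutral_cong_left)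
    fix k assume "k \<in> {k. k \<le> n \<and> [int k = r] (mod int (CARD('p) ^ \<beta>))}"
    moreover have "\<lfloor>of_int (int k - r) / (of_nat q :: rat)\<rfloor> = (int k - r) div int q"
      using floor_divide_of_int_eq[of "int k - r" "int q"] by simp
    ultimately show "of_nat (n choose k) * (-1) ^ k
        * poly f (of_int \<lfloor>of_int (int k - r) / (of_nat (CARD('p) ^ \<alpha>) :: rat)\<rfloor>)
      = of_nat (n choose k) * (-1) ^ k * g (int k)"
      by (simp add: g_def residue_poly_fun_def b_def q_def)
  qed (auto simp: g_def residue_poly_fun_def b_def)
  also have "\<dots> = shift_apply ([:1, -1:] ^ n) g 0"
    by (simp add: shift_apply_one_minus_shift_power)
  also have "\<dots> = of_nat (CARD('p) ^ e) * shift_apply u g 0"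
    unfolding uv shift_apply_add of_nat_power[symmetric] shift_apply_of_nat_mult
    by (simp add: shift_apply_mult J)
  also have "\<dots> \<in> prime_power_padic_integers E"
    using prime_power_padic_integersI[OF shift_apply_in_padic_integers[OF g], of E e]
    by (simp add: e_def)
  finally show ?thesis .
qed

text \<open>Clearing the denominator turns the floor into the weight inequality of
  \<open>power_in_ideal2_mixed\<close>; for \<alpha> \<ge> 1 the power p^(\<alpha>-1) is a natural
  number.\<close>

lemma floor_exponent_le:
  fixes t :: int
  assumes p: "prime p" and \<alpha>: "1 \<le> \<alpha>"
    and e: "int e = \<lfloor>(of_nat n - of_nat p powi (int \<alpha> - 1) - of_int t) / (of_nat (totient (p ^ \<alpha>)) :: rat)\<rfloor>
          - (int l - 1) * int \<alpha> - int \<beta>"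
  shows "(int e + (int l - 1) * int \<alpha> + int \<beta>) * int (p ^ (\<alpha> - 1) * (p - 1))
           + int (p ^ (\<alpha> - 1)) + t \<le> int n"
proof -
  define F where "F = int e + (int l - 1) * int \<alpha> + int \<beta>"
  define \<phi> where "\<phi> = p ^ (\<alpha> - 1) * (p - 1)"
  have tot: "totient (p ^ \<alpha>) = \<phi>"
    using \<alpha> by (simp add: \<phi>_def totient_prime_power[OF p])
  have \<phi>: "0 < \<phi>" using prime_gt_1_nat[OF p] by (simp add: \<phi>_def)
  have pw: "(of_nat p :: rat) powi (int \<alpha> - 1) = of_nat (p ^ (\<alpha> - 1))"
    using \<alpha> by (simp add: power_int_def nat_diff_distrib)
  have "F = \<lfloor>(of_nat n - of_nat (p ^ (\<alpha> - 1)) - of_int t) / (of_nat \<phi> :: rat)\<rfloor>"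
    using e unfolding F_def tot pw by simp
  then have "of_int F \<le> (of_nat n - of_nat (p ^ (\<alpha> - 1)) - of_int t) / (of_nat \<phi> :: rat)"
    by (simp add: le_floor_iff)
  then have "of_int F * of_nat \<phi> \<le> (of_nat n - of_nat (p ^ (\<alpha> - 1)) - of_int t :: rat)"
    using \<phi> by (simp add: pos_le_divide_eq)
  then have "(of_int (F * int \<phi> + int (p ^ (\<alpha> - 1)) + t) :: rat) \<le> of_int (int n)" by simp
  then show ?thesis unfolding of_int_le_iff F_def \<phi>_def .
qed

theorem theorem1p1:
  fixes p l \<alpha> \<beta> :: nat and f :: "'p :: prime_card padic poly"
  assumes p: "p = CARD('p)"
    and deg: "degree f \<le> l"
    and int_valued: "\<forall>a :: int. poly f (of_int a) \<in> padic_integers"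
    and le: "\<beta> \<le> \<alpha>"
  shows "(\<forall>(n :: nat) (r :: int). (of_nat n :: rat) \<ge> of_nat p powi (int \<alpha> - 1) \<longrightarrow>
           (\<Sum>k | k \<le> n \<and> [int k = r] (mod int (p ^ \<beta>)).
              of_nat (n choose k) * (-1) ^ k * poly f (of_int \<lfloor>of_int (int k - r) / (of_nat (p ^ \<alpha>) :: rat)\<rfloor>))
           \<in> prime_power_padic_integers
               (\<lfloor>(of_nat n - of_nat p powi (int \<alpha> - 1) - of_nat l) / (of_nat (totient (p ^ \<alpha>)) :: rat)\<rfloor>
                 - (int l - 1) * int \<alpha> - int \<beta>)) \<and>
         (\<alpha> > 1 \<longrightarrow>
          (\<forall>(n :: nat) (r :: int). (of_nat n :: rat) \<ge> of_nat p powi (int \<alpha> - 1) \<longrightarrow>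
           (\<Sum>k | k \<le> n \<and> [int k = r] (mod int (p ^ \<beta>)).
              of_nat (n choose k) * (-1) ^ k * poly f (of_int \<lfloor>of_int (int k - r) / (of_nat (p ^ \<alpha>) :: rat)\<rfloor>))
           \<in> prime_power_padic_integers
               (\<lfloor>(of_nat n - of_nat p powi (int \<alpha> - 1) - of_bool (\<beta> = 0)) / (of_nat (totient (p ^ \<alpha>)) :: rat)\<rfloor>
                 - (int l - 1) * int \<alpha> - int \<beta>)))"
proof -
  have prime: "prime p" using prime_card[where 'a = 'p] p by simp
  have ge: "p ^ (\<alpha> - 1) \<le> n" if "1 \<le> \<alpha>" "(of_nat n :: rat) \<ge> of_nat p powi (int \<alpha> - 1)" for n
  proof -
    have "(of_nat p :: rat) powi (int \<alpha> - 1) = of_nat (p ^ (\<alpha> - 1))"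
      using that(1) by (simp add: power_int_def nat_diff_distrib)
    then show ?thesis using that(2) by (simp only: of_nat_le_iff)
  qed
  show ?thesis
  proof (intro conjI allI impI)
    fix n :: nat and r :: int
    assume n: "(of_nat n :: rat) \<ge> of_nat p powi (int \<alpha> - 1)"
    show "(\<Sum>k | k \<le> n \<and> [int k = r] (mod int (p ^ \<beta>)).
        of_nat (n choose k) * (-1) ^ k * poly f (of_int \<lfloor>of_int (int k - r) / (of_nat (p ^ \<alpha>) :: rat)\<rfloor>))
      \<in> prime_power_padic_integers
          (\<lfloor>(of_nat n - of_nat p powi (int \<alpha> - 1) - of_nat l) / (of_nat (totient (p ^ \<alpha>)) :: rat)\<rfloor>
            - (int l - 1) * int \<alpha> - int \<beta>)"
      (is "_ \<in> prime_power_padic_integers ?E")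
      unfolding p
    proof (rule alternating_sum_in_prime_power_padic_integers[OF deg int_valued le], fold p)
      fix e assume e: "int e = ?E" "0 < e"
      show "[:-1, 1:] ^ n \<in> ideal2 (of_nat p ^ e)
          (((1 + [:-1, 1:]) ^ (p ^ \<alpha>) - 1) ^ l * ((1 + [:-1, 1:]) ^ (p ^ \<beta>) - 1) :: int poly)"
      proof (cases "\<alpha> = 0")
        \<comment> \<open>Now p^(\<alpha>-1) = 1/p and \<beta> = 0, so P and M both equal x and the
          second generator is x^(l+1). A positive exponent forces n > l.\<close>
        case True
        have "0 < (of_nat p powi (- 1) :: rat)" using prime_gt_0_nat[OF prime] by simp
        moreover have "of_int (int e) \<le> (of_nat n - of_nat p powi (- 1) - of_nat l :: rat)"
          using e(1) True le by (simp add: le_floor_iff)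
        ultimately have "(of_nat (e + l) :: rat) < of_nat n"
          unfolding of_nat_add of_int_of_nat_eq by linarith
        then have "Suc l \<le> n" using e(2) unfolding of_nat_less_iff by simp
        then have "[:-1, 1 :: int:] ^ n = [:-1, 1:] ^ Suc l * [:-1, 1:] ^ (n - Suc l)"
          by (simp flip: power_add del: power_Suc)
        then show ?thesis
          using ideal2_mult_right[OF ideal2_one_right, of "[:-1, 1 :: int:] ^ Suc l"] True le
          by (simp add: mult.commute)
      next
        case False
        \<comment> \<open>The choice t = l meets all conditions on t, also at \<alpha> = 1.\<close>
        then show ?thesis
          using floor_exponent_le[of p \<alpha> e n "int l" l \<beta>] e prime ge[OF _ n] le
          by (intro power_in_ideal2_mixed[where t = "int l"]) auto
      qed
    qed
  next
    fix n :: nat and r :: int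
    assume \<alpha>: "1 < \<alpha>" and n: "(of_nat n :: rat) \<ge> of_nat p powi (int \<alpha> - 1)"
    show "(\<Sum>k | k \<le> n \<and> [int k = r] (mod int (p ^ \<beta>)).
        of_nat (n choose k) * (-1) ^ k * poly f (of_int \<lfloor>of_int (int k - r) / (of_nat (p ^ \<alpha>) :: rat)\<rfloor>))
      \<in> prime_power_padic_integers
          (\<lfloor>(of_nat n - of_nat p powi (int \<alpha> - 1) - of_bool (\<beta> = 0)) / (of_nat (totient (p ^ \<alpha>)) :: rat)\<rfloor>
            - (int l - 1) * int \<alpha> - int \<beta>)"
      (is "_ \<in> prime_power_padic_integers ?E")
      unfolding p
    proof (rule alternating_sum_in_prime_power_padic_integers[OF deg int_valued le], fold p)
      fix e assume e: "int e = ?E"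
      \<comment> \<open>With \<alpha> > 1 the condition t = l is void, and t only has to supply the
        factor x when \<beta> = 0.\<close>
      show "[:-1, 1:] ^ n \<in> ideal2 (of_nat p ^ e)
          (((1 + [:-1, 1:]) ^ (p ^ \<alpha>) - 1) ^ l * ((1 + [:-1, 1:]) ^ (p ^ \<beta>) - 1) :: int poly)"
        using floor_exponent_le[of p \<alpha> e n "of_bool (\<beta> = 0)" l \<beta>] e prime ge[OF _ n] le \<alpha>
        by (intro power_in_ideal2_mixed[where t = "of_bool (\<beta> = 0)"]) auto
    qed
  qed
qed

end
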